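(* The basis exchange walk on the Vámos matroid is positively curved, i.e. its Ollivier--Ricci curvature satisfies $\kappa>0$.
   Context: The Vámos matroid is the rank-$4$ matroid on an $8$-element set $E=A_1\sqcup A_2\sqcup A_3\sqcup A_4$ with $\#A_i=2$, whose bases are all $4$-element subsets of $E$ except the five sets $A_1\cup A_2$, $A_1\cup A_3$, $A_1\cup A_4$, $A_2\cup A_3$, $A_2\cup A_4$ (so there are $65$ bases). For a matroid $\mathcal{M}=(E,\mathcal{B})$ with set of bases $\mathcal{B}$ all of size $k$, write $B-u$ for $B\setminus\{u\}$. The basis exchange walk (down-up walk) on $\mathcal{M}$ is the Markov chain $P$ on $\mathcal{B}$ that from $S\in\mathcal{B}$ drops an element $u\in S$ chosen uniformly at random, then moves to a uniformly random basis containing $S-u$ (possibly $S$ itself). The metric on $\mathcal{B}$ is $d(S,T)=\inf\{t\ge 0: P^t(S,T)>0\}$. The Wasserstein distance is $\mathcal{W}(\mu,\nu)=\min \mathbb{E}\, d(X,Y)$, the minimum being over all couplings $(X,Y)$ of $X\sim\mu$ and $Y\sim\nu$. The Ollivier--Ricci curvature $\kappa$ of $P$ is the largest $\kappa$ such that $\mathcal{W}(P(S,\cdot),P(T,\cdot))\le(1-\kappa)\,d(S,T)$ for all $S,T\in\mathcal{B}$, i.e. $\kappa=\inf_{S\ne T}\left(1-\mathcal{W}(P(S,\cdot),P(T,\cdot))/d(S,T)\right)$. *)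

theory Defs
  imports "HOL-Probability.Probability"
begin

locale matroid =
  fixes E :: "'a set" and Bs :: "'a set set"
  assumes finite_ground: "finite E"
    and bases_subset: "B \<in> Bs \<Longrightarrow> B \<subseteq> E"
    and bases_nonempty: "Bs \<noteq> {}"
    and exchange: "S \<in> Bs \<Longrightarrow> T \<in> Bs \<Longrightarrow> x \<in> S - T \<Longrightarrow>
      \<exists>y \<in> T - S. insert y (S - {x}) \<in> Bs"

text \<open>The Vamos matroid is only determined up to isomorphism; the four blocks
  \<open>A 1, \<dots>, A 4\<close> are meant to be pairwise disjoint two-element sets. Of the six unions of two
  blocks, only \<open>A 3 \<union> A 4\<close> is a basis.\<close>

definition vamos_ground :: "(nat \<Rightarrow> 'a set) \<Rightarrow> 'a set" where
  "vamos_ground A = (\<Union>i\<in>{1..4}. A i)"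

definition vamos_bases :: "(nat \<Rightarrow> 'a set) \<Rightarrow> 'a set set" where
  "vamos_bases A = {B. B \<subseteq> vamos_ground A \<and> card B = 4} -
     {A 1 \<union> A 2, A 1 \<union> A 3, A 1 \<union> A 4, A 2 \<union> A 3, A 2 \<union> A 4}"

text \<open>The walk is only meaningful when started in a member of \<open>Bs\<close>: otherwise the set
  passed to the inner \<^const>\<open>pmf_of_set\<close> may be empty.\<close>

definition basis_exchange_walk :: "'a set set \<Rightarrow> 'a set \<Rightarrow> 'a set pmf" where
  "basis_exchange_walk Bs S =
     bind_pmf (pmf_of_set S) (\<lambda>u. pmf_of_set {T \<in> Bs. S - {u} \<subseteq> T})"

primrec kernel_power :: "('s \<Rightarrow> 's pmf) \<Rightarrow> nat \<Rightarrow> 's \<Rightarrow> 's pmf" where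
  "kernel_power P 0 x = return_pmf x"
| "kernel_power P (Suc t) x = bind_pmf (P x) (kernel_power P t)"

text \<open>Distances are extended naturals, so that the infimum over the empty set is \<open>\<infinity>\<close>.\<close>

definition chain_dist :: "('s \<Rightarrow> 's pmf) \<Rightarrow> 's \<Rightarrow> 's \<Rightarrow> enat" where
  "chain_dist P x y = (INF t\<in>{t. pmf (kernel_power P t x) y > 0}. enat t)"

definition couplings :: "'s pmf \<Rightarrow> 's pmf \<Rightarrow> ('s \<times> 's) pmf set" where
  "couplings \<mu> \<nu> = {q. map_pmf fst q = \<mu> \<and> map_pmf snd q = \<nu>}"

definition wasserstein :: "('s \<Rightarrow> 's \<Rightarrow> enat) \<Rightarrow> 's pmf \<Rightarrow> 's pmf \<Rightarrow> ennreal" where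
  "wasserstein d \<mu> \<nu> =
     (INF q\<in>couplings \<mu> \<nu>. \<integral>\<^sup>+ (x, y). ennreal_of_enat (d x y) \<partial>measure_pmf q)"

text \<open>Intended for chains that are irreducible on \<open>\<Omega>\<close>; \<open>z / \<infinity> = 0\<close> in \<^typ>\<open>ereal\<close> makes the
  quotient meaningless for unreachable pairs.\<close>

definition ollivier_ricci_curvature :: "'s set \<Rightarrow> ('s \<Rightarrow> 's pmf) \<Rightarrow> ereal" where
  "ollivier_ricci_curvature \<Omega> P =
     (INF (x, y)\<in>{(x, y). x \<in> \<Omega> \<and> y \<in> \<Omega> \<and> x \<noteq> y}.
        1 - enn2ereal (wasserstein (chain_dist P) (P x) (P y)) / ereal_of_enat (chain_dist P x y))"

context
  fixes A :: "nat \<Rightarrow> 'a set"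
  assumes disj: "disjoint_family_on A {1..4}"
    and card2: "\<And>i. i \<in> {1..4} \<Longrightarrow> card (A i) = 2"
begin

private lemma ground_eq: "vamos_ground A = A 1 \<union> A 2 \<union> A 3 \<union> A 4"
proof -
  have "{1..4} = {1, 2, 3, 4::nat}" by auto
  then show ?thesis by (auto simp: vamos_ground_def)
qed

private lemma fin: "i \<in> {1..4} \<Longrightarrow> finite (A i)"
  using card2[of i] by (auto intro: card_ge_0_finite)

private lemma inter: "i \<in> {1..4} \<Longrightarrow> j \<in> {1..4} \<Longrightarrow> i \<noteq> j \<Longrightarrow> A i \<inter> A j = {}"
  using disj by (auto simp: disjoint_family_on_def)

lemma card_vamos_ground: "card (vamos_ground A) = 8"
proof -
  have "card (vamos_ground A) = (\<Sum>i\<in>{1..4}. card (A i))"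
    unfolding vamos_ground_def
    by (rule card_UN_disjoint) (use fin inter in auto)
  also have "\<dots> = 8" using card2 by simp
  finally show ?thesis .
qed

private definition Ex :: "'a set set" where
  "Ex = {A 1 \<union> A 2, A 1 \<union> A 3, A 1 \<union> A 4, A 2 \<union> A 3, A 2 \<union> A 4}"

private lemma vamos_bases_iff:
  "B \<in> vamos_bases A \<longleftrightarrow> B \<subseteq> vamos_ground A \<and> card B = 4 \<and> B \<notin> Ex"
  unfolding vamos_bases_def Ex_def by (simp only: Diff_iff mem_Collect_eq conj_assoc)

private lemma Ex_props:
  "card Ex = 5" "X \<in> Ex \<Longrightarrow> card X = 4 \<and> X \<subseteq> vamos_ground A"
  "X \<in> Ex \<Longrightarrow> Y \<in> Ex \<Longrightarrow> X \<noteq> Y \<Longrightarrow> card (X \<inter> Y) \<le> 2"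
proof -
  note [simp del] = One_nat_def
  have nd: "x \<notin> A k" if "x \<in> A j" "j \<in> {1..4}" "k \<in> {1..4}" "j \<noteq> k" for x j k
    using inter[OF that(2-4)] that(1) by blast
  have i: "A 1 \<inter> A 2 = {}" "A 1 \<inter> A 3 = {}" "A 1 \<inter> A 4 = {}"
      "A 2 \<inter> A 1 = {}" "A 2 \<inter> A 3 = {}" "A 2 \<inter> A 4 = {}"
      "A 3 \<inter> A 1 = {}" "A 3 \<inter> A 2 = {}" "A 3 \<inter> A 4 = {}"
      "A 4 \<inter> A 1 = {}" "A 4 \<inter> A 2 = {}" "A 4 \<inter> A 3 = {}"
    by (simp_all add: inter)
  have "A 1 \<noteq> {}" "A 2 \<noteq> {}" "A 3 \<noteq> {}" "A 4 \<noteq> {}"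
    using card2[of 1] card2[of 2] card2[of 3] card2[of 4] by auto
  then obtain a b c d where abcd: "a \<in> A 1" "b \<in> A 2" "c \<in> A 3" "d \<in> A 4"
    unfolding ex_in_conv[symmetric] by (elim exE)
  then have m: "a \<in> A 1" "a \<notin> A 2" "a \<notin> A 3" "a \<notin> A 4"
      "b \<notin> A 1" "b \<in> A 2" "b \<notin> A 3" "b \<notin> A 4"
      "c \<notin> A 1" "c \<notin> A 2" "c \<in> A 3" "c \<notin> A 4"
      "d \<notin> A 1" "d \<notin> A 2" "d \<notin> A 3" "d \<in> A 4"
    by (simp_all add: nd[OF abcd(1)] nd[OF abcd(2)] nd[OF abcd(3)] nd[OF abcd(4)])
  have sep: "X \<noteq> Y" if "\<exists>x \<in> {a, b, c, d}. (x \<in> X) \<noteq> (x \<in> Y)" for X Y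
    using that by blast
  have "A 1 \<union> A 2 \<noteq> A 1 \<union> A 3"
    "A 1 \<union> A 2 \<noteq> A 1 \<union> A 4"
    "A 1 \<union> A 2 \<noteq> A 2 \<union> A 3"
    "A 1 \<union> A 2 \<noteq> A 2 \<union> A 4"
    "A 1 \<union> A 3 \<noteq> A 1 \<union> A 4"
    "A 1 \<union> A 3 \<noteq> A 2 \<union> A 3"
    "A 1 \<union> A 3 \<noteq> A 2 \<union> A 4"
    "A 1 \<union> A 4 \<noteq> A 2 \<union> A 3"
    "A 1 \<union> A 4 \<noteq> A 2 \<union> A 4"
    "A 2 \<union> A 3 \<noteq> A 2 \<union> A 4"
    by (rule sep; simp add: m)+
  then show "card Ex = 5"
    unfolding Ex_def by (simp only: card_insert_if finite.intros insert_iff empty_iff) simp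
  have c: "card (A 1) = 2" "card (A 2) = 2" "card (A 3) = 2" "card (A 4) = 2"
      "finite (A 1)" "finite (A 2)" "finite (A 3)" "finite (A 4)"
    by (simp_all add: card2 fin)
  show "X \<in> Ex \<Longrightarrow> card X = 4 \<and> X \<subseteq> vamos_ground A"
    unfolding ground_eq Ex_def
    by (elim insertE emptyE; simp add: card_Un_disjoint i c; fast)
  show "card (X \<inter> Y) \<le> 2" if "X \<in> Ex" "Y \<in> Ex" "X \<noteq> Y"
    using that unfolding Ex_def
    by (elim insertE emptyE; simp add: Int_Un_distrib Int_Un_distrib2 i c)
qed

lemma card_vamos_bases: "card (vamos_bases A) = 65"
proof -
  have f: "finite (vamos_ground A)"
    using card_vamos_ground by (intro card_ge_0_finite) simp
  have "card {B. B \<subseteq> vamos_ground A \<and> card B = 4} = 8 choose 4"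
    using n_subsets[OF f, of 4] card_vamos_ground by simp
  also have "\<dots> = 70" by (simp add: eval_nat_numeral)
  finally have "card {B. B \<subseteq> vamos_ground A \<and> card B = 4} = 70" .
  moreover have "Ex \<subseteq> {B. B \<subseteq> vamos_ground A \<and> card B = 4}"
    using Ex_props(2) by blast
  moreover have "finite Ex" using Ex_props(1) by (intro card_ge_0_finite) simp
  moreover have "vamos_bases A = {B. B \<subseteq> vamos_ground A \<and> card B = 4} - Ex"
    by (simp only: vamos_bases_def Ex_def)
  ultimately show ?thesis
    using Ex_props(1) by (simp add: card_Diff_subset)
qed

lemma matroid_vamos: "matroid (vamos_ground A) (vamos_bases A)"
proof
  show f: "finite (vamos_ground A)"
    using card_vamos_ground by (intro card_ge_0_finite) simp
  show "B \<subseteq> vamos_ground A" if "B \<in> vamos_bases A" for B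
    using that by (simp add: vamos_bases_iff)
  show "vamos_bases A \<noteq> {}"
    using card_vamos_bases by auto
  show "\<exists>y \<in> T - S. insert y (S - {x}) \<in> vamos_bases A"
    if S: "S \<in> vamos_bases A" and T: "T \<in> vamos_bases A" and x: "x \<in> S - T" for S T x
  proof (rule ccontr)
    assume "\<not> ?thesis"
    then have no: "insert y (S - {x}) \<notin> vamos_bases A" if "y \<in> T - S" for y
      using that by blast
    have sub: "S \<subseteq> vamos_ground A" "T \<subseteq> vamos_ground A" "card S = 4" "card T = 4"
      using S T by (simp_all add: vamos_bases_iff)
    then have fin: "finite S" "finite T"
      using f finite_subset by blast+
    have c3: "card (S - {x}) = 3"
      using x sub(3) card_Diff_singleton[of x S] by simp
    have ex: "insert y (S - {x}) \<in> Ex" if y: "y \<in> T - S" for y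
    proof -
      have "insert y (S - {x}) \<subseteq> vamos_ground A" using y sub(1,2) by blast
      moreover have "card (insert y (S - {x})) = 4" using y c3 fin(1) by simp
      ultimately show ?thesis
        using no[OF y] by (simp add: vamos_bases_iff)
    qed
    have "T - S \<noteq> {}"
      using card_subset_eq[OF fin(1), of T] sub(3,4) x by auto
    then obtain y where y: "y \<in> T - S" by blast
    have "z = y" if z: "z \<in> T - S" for z
    proof (rule ccontr)
      assume "z \<noteq> y"
      then have "insert z (S - {x}) \<noteq> insert y (S - {x})"
        using y z by blast
      then have "card (insert z (S - {x}) \<inter> insert y (S - {x})) \<le> 2"
        using Ex_props(3) ex y z by blast
      moreover have "card (S - {x}) \<le> card (insert z (S - {x}) \<inter> insert y (S - {x}))"
        by (rule card_mono) (use fin in auto)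
      ultimately show False using c3 by simp
    qed
    then have "T \<subseteq> insert y (S - {x})" using x by blast
    moreover have "card (insert y (S - {x})) = 4" using c3 fin y by simp
    ultimately have "T = insert y (S - {x})"
      using sub(4) fin(1) by (intro card_subset_eq) simp_all
    then show False using no[OF y] T by simp
  qed
qed

end

end

theory Submission
  imports Defs
begin

text \<open>
  Any two of the excluded sets meet in at most two elements, so the argument works for every
  sparse paving matroid of rank \<open>r\<close> and gives \<open>\<kappa> \<ge> 1/r\<close>. Let \<open>S = J \<union> {a, u}\<close> and
  \<open>T = J \<union> {b, u}\<close> be adjacent bases, and let the walk from \<open>T\<close> drop the image of the element
  dropped from \<open>S\<close> under the transposition \<open>(a b)\<close>. If \<open>a\<close> is dropped from \<open>S\<close>, both walks
  continue from the same set and are coupled at distance 0. If \<open>u \<noteq> a\<close> is dropped,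
  the new bases are uniform among the completions of \<open>J \<union> {a}\<close> and \<open>J \<union> {b}\<close>, of which at most
  one each is missing, and they are matched by the transposition. Unless it is excluded, the common
  completion \<open>M = J \<union> {a, b}\<close> is matched to itself at cost 0, which pays for the at most one
  unmatched completion, of cost at most 2 because every completion is adjacent to \<open>M\<close>. So
  the expected distance is at most 1, and adjacent bases contract by \<open>1 - 1/r\<close>. Gluing couplings
  along shortest paths extends this to all pairs of bases.
\<close>

section \<open>Transport costs\<close>

text \<open>Asks for an actual coupling of cost at most \<open>c\<close>, not for a bound on the
  infimum, so that couplings can be glued and mixed without approximating a minimum.\<close>

definition transport_le :: "('s \<Rightarrow> 's \<Rightarrow> enat) \<Rightarrow> 's pmf \<Rightarrow> 's pmf \<Rightarrow> ennreal \<Rightarrow> bool" where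
  "transport_le d \<mu> \<nu> c \<longleftrightarrow>
     (\<exists>q\<in>couplings \<mu> \<nu>. (\<integral>\<^sup>+ (x, y). ennreal_of_enat (d x y) \<partial>measure_pmf q) \<le> c)"

lemma wasserstein_le: "transport_le d \<mu> \<nu> c \<Longrightarrow> wasserstein d \<mu> \<nu> \<le> c"
  unfolding transport_le_def wasserstein_def by (meson INF_lower2)

lemma transport_le_mono: "transport_le d \<mu> \<nu> c \<Longrightarrow> c \<le> c' \<Longrightarrow> transport_le d \<mu> \<nu> c'"
  unfolding transport_le_def by (meson order_trans)

lemma transport_le_refl:
  assumes "\<And>x. d x x = 0"
  shows "transport_le d \<mu> \<mu> 0"
  unfolding transport_le_def couplings_def
  by (intro bexI[of _ "map_pmf (\<lambda>x. (x, x)) \<mu>"]) (auto simp: assms pmf.map_comp comp_def)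

lemma transport_le_swap:
  assumes "transport_le (\<lambda>x y. d y x) \<mu> \<nu> c"
  shows "transport_le d \<nu> \<mu> c"
proof -
  obtain q where q: "map_pmf fst q = \<mu>" "map_pmf snd q = \<nu>"
    "(\<integral>\<^sup>+ (x, y). ennreal_of_enat (d y x) \<partial>measure_pmf q) \<le> c"
    using assms by (auto simp: transport_le_def couplings_def)
  show ?thesis
    unfolding transport_le_def couplings_def
    using q by (intro bexI[of _ "map_pmf prod.swap q"]) (auto simp: pmf.map_comp comp_def split_beta')
qed

text \<open>Gluing: two couplings that share the marginal \<nu> are joined so that their outer
  coordinates are independent given the middle one; the triangle inequality then adds the
  costs.\<close>

lemma transport_le_trans:
  assumes d: "\<And>x y z. d x z \<le> d x y + d y z"
    and "transport_le d \<mu> \<nu> c" "transport_le d \<nu> \<rho> c'"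
  shows "transport_le d \<mu> \<rho> (c + c')"
proof -
  obtain p where p: "map_pmf fst p = \<mu>" "map_pmf snd p = \<nu>"
    "(\<integral>\<^sup>+ (x, y). ennreal_of_enat (d x y) \<partial>measure_pmf p) \<le> c"
    using assms(2) by (auto simp: transport_le_def couplings_def)
  obtain q where q: "map_pmf fst q = \<nu>" "map_pmf snd q = \<rho>"
    "(\<integral>\<^sup>+ (x, y). ennreal_of_enat (d x y) \<partial>measure_pmf q) \<le> c'"
    using assms(3) by (auto simp: transport_le_def couplings_def)
  \<comment> \<open>First draw \<open>(x, y)\<close> from \<open>p\<close>, then a pair from
    \<open>q\<close> conditioned on its first coordinate being \<open>y\<close>.\<close>
  define g where "g = bind_pmf p (\<lambda>xy. map_pmf (Pair xy) (cond_pmf q {yz. snd xy = fst yz}))"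
  \<comment> \<open>Equal mass of the fibres over each middle point is what makes the second
    marginal of \<open>g\<close> equal to \<open>q\<close>.\<close>
  have meas: "measure p {xy. snd xy = y} = measure q {yz. y = fst yz}" for y
  proof -
    have "measure p (snd -` {y}) = measure q (fst -` {y})"
      unfolding measure_map_pmf[symmetric] p q ..
    then show ?thesis by (simp add: vimage_def eq_commute)
  qed
  have ne: "set_pmf q \<inter> {yz. snd xy = fst yz} \<noteq> {}" if "xy \<in> set_pmf p" for xy
  proof -
    have "snd xy \<in> set_pmf (map_pmf fst q)"
      using that p(2) q(1) by (metis imageI set_map_pmf)
    then show ?thesis by auto
  qed
  have g1: "map_pmf fst g = p"
    by (simp add: g_def map_bind_pmf pmf.map_comp comp_def bind_return_pmf')
  have im: "snd ` set_pmf p = fst ` set_pmf q"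
    by (metis p(2) q(1) set_map_pmf)
  have "rel_set (\<lambda>xy yz. snd xy = fst yz) (set_pmf p) (set_pmf q)"
  proof (rule rel_setI)
    show "\<exists>yz\<in>set_pmf q. snd xy = fst yz" if "xy \<in> set_pmf p" for xy
      using im that by (metis imageE imageI)
    show "\<exists>xy\<in>set_pmf p. snd xy = fst yz" if "yz \<in> set_pmf q" for yz
      using im that by (metis imageE imageI)
  qed
  then have g2: "map_pmf snd g = q"
    unfolding g_def map_bind_pmf pmf.map_comp comp_def snd_conv map_pmf_ident
    by (intro bind_cond_pmf_cancel) (auto simp: rel_set_def meas)
  have supp: "snd xy = fst yz" if "(xy, yz) \<in> set_pmf g" for xy yz
    using that ne by (auto simp: g_def)
  let ?r = "map_pmf (\<lambda>(xy, yz). (fst xy, snd yz)) g"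
  have "map_pmf fst ?r = \<mu>"
    unfolding p(1)[symmetric] g1[symmetric] by (simp add: pmf.map_comp comp_def split_beta)
  moreover have "map_pmf snd ?r = \<rho>"
    unfolding q(2)[symmetric] g2[symmetric] by (simp add: pmf.map_comp comp_def split_beta)
  moreover have "(\<integral>\<^sup>+ (x, z). ennreal_of_enat (d x z) \<partial>measure_pmf ?r) \<le> c + c'"
  proof -
    have "(\<integral>\<^sup>+ (x, z). ennreal_of_enat (d x z) \<partial>measure_pmf ?r) =
        (\<integral>\<^sup>+ w. ennreal_of_enat (d (fst (fst w)) (snd (snd w))) \<partial>measure_pmf g)"
      by (simp add: split_beta)
    also have "\<dots> \<le> (\<integral>\<^sup>+ w. (ennreal_of_enat (d (fst (fst w)) (snd (fst w))) +
         ennreal_of_enat (d (fst (snd w)) (snd (snd w)))) \<partial>measure_pmf g)"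
    proof (rule nn_integral_mono_AE, rule AE_pmfI)
      fix w assume "w \<in> set_pmf g"
      then have "snd (fst w) = fst (snd w)" using supp[of "fst w" "snd w"] by simp
      then show "ennreal_of_enat (d (fst (fst w)) (snd (snd w))) \<le>
          ennreal_of_enat (d (fst (fst w)) (snd (fst w))) +
          ennreal_of_enat (d (fst (snd w)) (snd (snd w)))"
        using d[of "fst (fst w)" "snd (snd w)" "snd (fst w)"]
        by (simp flip: ennreal_of_enat_plus)
    qed
    also have "\<dots> = (\<integral>\<^sup>+ (x, y). ennreal_of_enat (d x y) \<partial>map_pmf fst g) +
        (\<integral>\<^sup>+ (y, z). ennreal_of_enat (d y z) \<partial>map_pmf snd g)"
      by (simp add: nn_integral_add split_beta)
    also have "\<dots> \<le> c + c'"
      unfolding g1 g2 using p(3) q(3) by (rule add_mono)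
    finally show ?thesis .
  qed
  ultimately show ?thesis unfolding transport_le_def couplings_def by blast
qed

text \<open>Convexity of the transport cost: a coupling is chosen for each \<open>u\<close>, and the
  mixture of these couplings has the average cost.\<close>

lemma transport_le_bind:
  assumes "\<And>u. u \<in> set_pmf p \<Longrightarrow> transport_le d (f u) (g u) (c u)"
  shows "transport_le d (bind_pmf p f) (bind_pmf p g) (\<integral>\<^sup>+ u. c u \<partial>measure_pmf p)"
proof -
  obtain q where q: "\<And>u. u \<in> set_pmf p \<Longrightarrow> map_pmf fst (q u) = f u"
    "\<And>u. u \<in> set_pmf p \<Longrightarrow> map_pmf snd (q u) = g u"
    "\<And>u. u \<in> set_pmf p \<Longrightarrow> (\<integral>\<^sup>+ (x, y). ennreal_of_enat (d x y) \<partial>measure_pmf (q u)) \<le> c u"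
    using assms unfolding transport_le_def couplings_def mem_Collect_eq Bex_def by metis
  have "map_pmf fst (bind_pmf p q) = bind_pmf p f" "map_pmf snd (bind_pmf p q) = bind_pmf p g"
    using q by (auto simp: map_bind_pmf intro!: bind_pmf_cong)
  moreover have "(\<integral>\<^sup>+ (x, y). ennreal_of_enat (d x y) \<partial>measure_pmf (bind_pmf p q))
      \<le> (\<integral>\<^sup>+ u. c u \<partial>measure_pmf p)"
    using q(3) by (auto intro!: nn_integral_mono_AE AE_pmfI)
  ultimately show ?thesis unfolding transport_le_def couplings_def by blast
qed

section \<open>Couplings of uniform distributions on finite sets\<close>

text \<open>Rejection sampling with a single retry: an accepted point is uniform on
  \<open>A\<close>, and a rejected one is redrawn uniformly from \<open>A\<close>.\<close>

lemma bind_pmf_of_set_reject: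
  assumes "finite C" "A \<subseteq> C" "A \<noteq> {}"
  shows "bind_pmf (pmf_of_set C) (\<lambda>x. if x \<in> A then return_pmf x else pmf_of_set A) = pmf_of_set A"
proof (rule pmf_eqI)
  fix i
  have fA: "finite A" using assms finite_subset by blast
  have cA: "card A > 0" using fA assms by (simp add: card_gt_0_iff)
  have cC: "card C \<ge> card A" using assms by (simp add: card_mono)
  have "(\<Sum>x\<in>C. pmf (if x \<in> A then return_pmf x else pmf_of_set A) i) =
      (\<Sum>x\<in>A. indicator {x} i) + (\<Sum>x\<in>C - A. indicator A i / card A :: real)"
    using assms fA
    by (subst sum.subset_diff[OF assms(2,1)]) (simp add: pmf_return indicator_def)
  also have "(\<Sum>x\<in>A. indicator {x} i) = (indicator A i :: real)"
    using fA by (simp add: indicator_def if_distrib[of "\<lambda>x. x"] sum.delta cong: if_cong)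
  also have "indicator A i + (\<Sum>x\<in>C - A. indicator A i / card A :: real) =
      card C * (indicator A i / card A)"
    using cA cC assms fA by (simp add: card_Diff_subset of_nat_diff field_simps)
  finally show "pmf (bind_pmf (pmf_of_set C)
      (\<lambda>x. if x \<in> A then return_pmf x else pmf_of_set A)) i = pmf (pmf_of_set A) i"
    using assms fA cA cC by (subst pmf_bind_pmf_of_set) (auto)
qed

text \<open>Draw \<open>y\<close> from \<open>B\<close> and propose \<phi>\<open>y\<close>, which is
  uniform on the image of \<open>B\<close>. A proposal outside \<open>A\<close> is redrawn from
  \<open>A\<close>, at a cost bounded by 2 through \<open>far\<close>.\<close>

lemma transport_le_reject:
  assumes B: "finite B" "B \<noteq> {}" and inj: "inj_on \<phi> B" and A: "A \<subseteq> \<phi> ` B" "A \<noteq> {}"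
    and far: "\<And>x y. x \<in> A \<Longrightarrow> y \<in> B \<Longrightarrow> d x y \<le> 2"
  shows "transport_le d (pmf_of_set A) (pmf_of_set B)
    ((\<Sum>y\<in>B. if \<phi> y \<in> A then ennreal_of_enat (d (\<phi> y) y) else 2) / card B)"
proof -
  let ?k = "\<lambda>y. if \<phi> y \<in> A then return_pmf (\<phi> y) else pmf_of_set A"
  let ?c = "\<lambda>y. if \<phi> y \<in> A then ennreal_of_enat (d (\<phi> y) y) else 2"
  have fA: "finite A" using A B finite_subset by blast
  have "bind_pmf (pmf_of_set B) ?k =
      bind_pmf (map_pmf \<phi> (pmf_of_set B)) (\<lambda>x. if x \<in> A then return_pmf x else pmf_of_set A)"
    by (simp add: bind_map_pmf)
  also have "\<dots> = pmf_of_set A"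
    using B A inj by (simp add: map_pmf_of_set_inj bind_pmf_of_set_reject)
  finally have k: "bind_pmf (pmf_of_set B) ?k = pmf_of_set A" .
  have "transport_le d (?k y) (return_pmf y) (?c y)" if y: "y \<in> B" for y
    unfolding transport_le_def couplings_def
  proof (intro bexI[of _ "map_pmf (\<lambda>x. (x, y)) (?k y)"])
    have "(\<integral>\<^sup>+ x. ennreal_of_enat (d x y) \<partial>measure_pmf (pmf_of_set A)) \<le> 2"
    proof -
      have "ennreal_of_enat (d x y) \<le> 2" if "x \<in> A" for x
        using far[OF that y] by (metis ennreal_of_enat_enat ennreal_of_enat_le_iff numeral_eq_enat of_nat_numeral)
      then have "(\<integral>\<^sup>+ x. ennreal_of_enat (d x y) \<partial>measure_pmf (pmf_of_set A)) \<le>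
          (\<integral>\<^sup>+ x. 2 \<partial>measure_pmf (pmf_of_set A))"
        using fA A(2) by (intro nn_integral_mono_AE AE_pmfI) simp
      then show ?thesis by simp
    qed
    then show "(\<integral>\<^sup>+ (x, y). ennreal_of_enat (d x y)
        \<partial>measure_pmf (map_pmf (\<lambda>x. (x, y)) (?k y))) \<le> ?c y"
      by (simp add: nn_integral_return_pmf)
  qed (auto simp: pmf.map_comp comp_def map_pmf_const)
  then have "transport_le d (bind_pmf (pmf_of_set B) ?k) (bind_pmf (pmf_of_set B) return_pmf)
      (\<integral>\<^sup>+ y. ?c y \<partial>measure_pmf (pmf_of_set B))"
    using B by (intro transport_le_bind) simp
  then show ?thesis
    using B unfolding k bind_return_pmf' by (simp add: nn_integral_pmf_of_set)
qed

text \<open>\<open>z\<close> is the only point of \<open>B\<close> whose cost may exceed 1, either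
  because it is unmatched or because its partner is at distance 2. The free point \<open>M\<close>
  compensates for it in the average.\<close>

lemma transport_le_match:
  assumes B: "finite B" "B \<noteq> {}" and inj: "inj_on \<phi> B" and A: "A \<subseteq> \<phi> ` B" "A \<noteq> {}"
    and near: "\<And>y. y \<in> B \<Longrightarrow> \<phi> y \<in> A \<Longrightarrow> d (\<phi> y) y \<le> 1 \<or> y = z \<and> d (\<phi> y) y \<le> 2"
    and far: "\<And>x y. x \<in> A \<Longrightarrow> y \<in> B \<Longrightarrow> d x y \<le> 2"
    and unmatched: "\<And>y. y \<in> B \<Longrightarrow> \<phi> y \<notin> A \<Longrightarrow> y = z"
    and M: "M \<in> B" "\<phi> M = M" "M \<in> A" "d M M = 0"
  shows "transport_le d (pmf_of_set A) (pmf_of_set B) 1"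
proof (rule transport_le_mono[OF transport_le_reject[OF B inj A far]])
  let ?c = "\<lambda>y. if \<phi> y \<in> A then ennreal_of_enat (d (\<phi> y) y) else 2"
  \<comment> \<open>Integer cost bounds: 0 at \<open>M\<close>, otherwise 2 at \<open>z\<close> and
    1 elsewhere. They sum to at most \<open>card B\<close>, also when \<open>z\<close> equals
    \<open>M\<close> or lies outside \<open>B\<close>.\<close>
  let ?n = "\<lambda>y. if y = M then 0 else 1 + (if y = z then 1 else 0 :: nat)"
  have le2: "ennreal_of_enat e \<le> 2" if "e \<le> 2" for e
    using that by (metis ennreal_of_enat_enat ennreal_of_enat_le_iff numeral_eq_enat of_nat_numeral)
  have le1: "ennreal_of_enat e \<le> 1" if "e \<le> 1" for e
    using that by (metis ennreal_of_enat_1 ennreal_of_enat_le_iff)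
  have "?c y \<le> of_nat (?n y)" if y: "y \<in> B" for y
  proof (cases "y = M")
    case False
    have "ennreal_of_enat (d (\<phi> y) y) \<le> of_nat (?n y)" if "\<phi> y \<in> A"
      using near[OF y that]
    proof
      assume "d (\<phi> y) y \<le> 1"
      then have "ennreal_of_enat (d (\<phi> y) y) \<le> of_nat 1" using le1 by simp
      also have "\<dots> \<le> of_nat (?n y)" using False by (intro of_nat_mono) simp
      finally show ?thesis .
    next
      assume "y = z \<and> d (\<phi> y) y \<le> 2"
      then show ?thesis using False le2[of "d (\<phi> y) y"] by (auto simp: one_add_one)
    qed
    then show ?thesis using unmatched[OF y] False by (simp add: one_add_one)
  qed (use M in simp)
  then have "sum ?c B \<le> (\<Sum>y\<in>B. of_nat (?n y))"
    by (rule sum_mono)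
  also have "\<dots> = of_nat (\<Sum>y\<in>B. ?n y)"
    by (rule of_nat_sum[symmetric])
  also have "\<dots> \<le> of_nat (card B)"
  proof (intro of_nat_mono)
    have "(\<Sum>y\<in>B. ?n y) = (\<Sum>y\<in>B - {M}. 1 + (if y = z then 1 else 0))"
      using B M(1) by (subst sum.remove[OF B(1) M(1)]) (auto intro!: sum.cong)
    also have "\<dots> \<le> card (B - {M}) + 1"
      using B unfolding sum.distrib by simp
    also have "\<dots> = card B"
      using B M(1) card_Suc_Diff1[of B M] by simp
    finally show "(\<Sum>y\<in>B. ?n y) \<le> card B" .
  qed
  finally show "sum ?c B / card B \<le> 1"
    by (intro divide_le_posI_ennreal) (use B in \<open>simp_all add: card_gt_0_iff\<close>)
qed

lemma transport_le_bij:
  assumes B: "finite B" "B \<noteq> {}" and inj: "inj_on \<phi> B"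
    and near: "\<And>y. y \<in> B \<Longrightarrow> d (\<phi> y) y \<le> 1"
  shows "transport_le d (pmf_of_set (\<phi> ` B)) (pmf_of_set B) 1"
proof -
  have "transport_le d (bind_pmf (pmf_of_set B) (\<lambda>y. return_pmf (\<phi> y)))
     (bind_pmf (pmf_of_set B) return_pmf) (\<integral>\<^sup>+ y. 1 \<partial>measure_pmf (pmf_of_set B))"
  proof (rule transport_le_bind)
    fix y assume "y \<in> set_pmf (pmf_of_set B)"
    then have "ennreal_of_enat (d (\<phi> y) y) \<le> 1"
      using near B by (metis ennreal_of_enat_1 ennreal_of_enat_le_iff set_pmf_of_set)
    then show "transport_le d (return_pmf (\<phi> y)) (return_pmf y) 1"
      unfolding transport_le_def couplings_def
      by (intro bexI[of _ "return_pmf (\<phi> y, y)"]) auto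
  qed
  then show ?thesis
    using B inj by (simp add: bind_return_pmf' map_pmf_of_set_inj flip: map_pmf_def)
qed

section \<open>The distance of a Markov chain\<close>

text \<open>The Chapman-Kolmogorov equation.\<close>

lemma kernel_power_add:
  "kernel_power P (s + t) x = bind_pmf (kernel_power P s x) (kernel_power P t)"
  by (induction s arbitrary: x) (simp_all add: bind_return_pmf bind_assoc_pmf cong: bind_pmf_cong)

lemma chain_dist_le: "y \<in> set_pmf (kernel_power P t x) \<Longrightarrow> chain_dist P x y \<le> enat t"
  unfolding chain_dist_def by (rule INF_lower) (simp add: pmf_positive)

text \<open>A finite infimum is over a nonempty set of naturals, so it is a least element.\<close>

lemma chain_dist_attained:
  assumes "chain_dist P x y = enat t"
  shows "y \<in> set_pmf (kernel_power P t x)"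
proof -
  have "enat t \<in> enat ` {t. pmf (kernel_power P t x) y > 0}"
    using assms unfolding chain_dist_def Inf_enat_def
    by (auto split: if_splits) (metis (mono_tags, lifting) LeastI imageI mem_Collect_eq)
  then show ?thesis by (auto simp: set_pmf_iff)
qed

lemma chain_dist_self: "chain_dist P x x = 0"
  using chain_dist_le[of x P 0 x] by (simp add: zero_enat_def[symmetric])

lemma chain_dist_le_1: "y \<in> set_pmf (P x) \<Longrightarrow> chain_dist P x y \<le> 1"
  using chain_dist_le[of y P 1 x] by (simp add: bind_return_pmf' one_enat_def)

lemma chain_dist_triangle: "chain_dist P x z \<le> chain_dist P x y + chain_dist P y z"
proof (cases "chain_dist P x y"; cases "chain_dist P y z")
  fix s t assume st: "chain_dist P x y = enat s" "chain_dist P y z = enat t"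
  have "z \<in> set_pmf (kernel_power P (s + t) x)"
    using st[THEN chain_dist_attained] by (auto simp: kernel_power_add)
  then show ?thesis using chain_dist_le st by fastforce
qed auto

text \<open>Path coupling: the one-step bounds are glued along a trajectory of length
  \<open>t\<close>.\<close>

lemma transport_le_chain_dist:
  assumes step: "\<And>x y. x \<in> \<Omega> \<Longrightarrow> y \<in> set_pmf (P x) \<Longrightarrow>
      y \<in> \<Omega> \<and> transport_le (chain_dist P) (P x) (P y) c"
    and "x \<in> \<Omega>" "y \<in> set_pmf (kernel_power P t x)"
  shows "transport_le (chain_dist P) (P x) (P y) (of_nat t * c)"
  using assms(2,3)
proof (induction t arbitrary: x)
  case 0
  then show ?case by (simp add: transport_le_refl chain_dist_self)
next
  case (Suc t)
  then obtain z where z: "z \<in> set_pmf (P x)" "y \<in> set_pmf (kernel_power P t z)" by auto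
  then have "transport_le (chain_dist P) (P x) (P y) (c + of_nat t * c)"
    using step[OF Suc.prems(1) z(1)] Suc.IH[OF _ z(2)]
    by (intro transport_le_trans[where \<nu> = "P z"] chain_dist_triangle) auto
  then show ?case by (simp add: distrib_right)
qed

lemma curvature_ge:
  assumes step: "\<And>x y. x \<in> \<Omega> \<Longrightarrow> y \<in> set_pmf (P x) \<Longrightarrow>
      y \<in> \<Omega> \<and> transport_le (chain_dist P) (P x) (P y) (ennreal c)"
    and c: "0 \<le> c" "c \<le> 1"
  shows "ollivier_ricci_curvature \<Omega> P \<ge> ereal (1 - c)"
  unfolding ollivier_ricci_curvature_def
proof (rule INF_greatest, clarify)
  fix x y assume xy: "x \<in> \<Omega>" "y \<in> \<Omega>" "x \<noteq> y"
  let ?W = "wasserstein (chain_dist P) (P x) (P y)"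
  have "enn2ereal ?W / ereal_of_enat (chain_dist P x y) \<le> ereal c"
  proof (cases "chain_dist P x y")
    case (enat t)
    then have t: "y \<in> set_pmf (kernel_power P t x)" by (rule chain_dist_attained)
    \<comment> \<open>Zero steps reach only \<open>x\<close> itself; positivity permits the division
      by \<open>t\<close> below.\<close>
    then have "t > 0" using xy(3) by (cases t) auto
    have "?W \<le> of_nat t * ennreal c"
      by (rule wasserstein_le, rule transport_le_chain_dist[OF step xy(1) t])
    also have "\<dots> = ennreal (real t * c)"
      using c by (simp add: ennreal_mult ennreal_of_nat_eq_real_of_nat)
    finally have "enn2ereal ?W \<le> ereal (real t * c)"
      using c by (metis enn2ereal_ennreal less_eq_ennreal.rep_eq mult_nonneg_nonneg of_nat_0_le_iff)
    then have "enn2ereal ?W / ereal (real t) \<le> ereal (real t * c) / ereal (real t)"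
      using \<open>t > 0\<close> by (intro ereal_divide_right_mono) auto
    then show ?thesis using \<open>t > 0\<close> enat by simp
  \<comment> \<open>At infinite distance the quotient is 0, by the convention for division by
    \<infinity>.\<close>
  qed (use c in simp)
  then have "1 - ereal c \<le> 1 - enn2ereal ?W / ereal_of_enat (chain_dist P x y)"
    by (intro ereal_minus_mono) auto
  then show "ereal (1 - c) \<le> 1 - enn2ereal ?W / ereal_of_enat (chain_dist P x y)"
    by (simp add: one_ereal_def)
qed

section \<open>Sparse paving matroids\<close>

text \<open>The \<open>r\<close>-sets in \<open>N\<close> are pairwise non-adjacent in the Johnson
  graph, as are the circuit-hyperplanes of a sparse paving matroid. The form \<open>+ 2\<close>
  avoids truncated subtraction.\<close>

locale sparse_paving =
  fixes E :: "'a set" and N :: "'a set set" and r :: nat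
  assumes finite_E: "finite E"
    and rank_pos: "0 < r"
    and sparse: "X \<in> N \<Longrightarrow> Y \<in> N \<Longrightarrow> X \<noteq> Y \<Longrightarrow> card (X \<inter> Y) + 2 \<le> r"
begin

definition bases :: "'a set set" where
  "bases = {B. B \<subseteq> E \<and> card B = r} - N"

text \<open>Excluded sets are kept here, so that a transposition of the ground set acts bijectively;
  \<open>N\<close> is removed afterwards.\<close>

definition extensions :: "'a set \<Rightarrow> 'a set set" where
  "extensions K = {T. T \<subseteq> E \<and> card T = r \<and> K \<subseteq> T}"

abbreviation walk :: "'a set \<Rightarrow> 'a set pmf" where
  "walk \<equiv> basis_exchange_walk bases"

lemma bases_extensions: "{T \<in> bases. K \<subseteq> T} = extensions K - N"
  by (auto simp: bases_def extensions_def)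

lemma finite_extensions: "finite (extensions K)"
  using finite_E by (auto simp: extensions_def intro: finite_subset[of _ "Pow E"])

lemma finite_basis: "S \<in> bases \<Longrightarrow> finite S"
  using finite_E by (auto simp: bases_def intro: finite_subset)

lemma basis_nonempty: "S \<in> bases \<Longrightarrow> S \<noteq> {}"
  using rank_pos by (auto simp: bases_def)

lemma set_walk:
  assumes S: "S \<in> bases"
  shows "set_pmf (walk S) = {T \<in> bases. \<exists>u\<in>S. S - {u} \<subseteq> T}"
proof -
  \<comment> \<open>\<open>S\<close> itself is always a completion, so the inner uniform
    distribution is well defined.\<close>
  have "finite {T \<in> bases. S - {u} \<subseteq> T}" "{T \<in> bases. S - {u} \<subseteq> T} \<noteq> {}" for u
    using S by (simp_all add: bases_extensions finite_extensions) (auto simp: extensions_def bases_def)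
  then show ?thesis
    using finite_basis[OF S] basis_nonempty[OF S]
    by (auto simp: basis_exchange_walk_def)
qed

lemma dist_le_1:
  assumes "S \<in> bases" "T \<in> bases" "K \<subseteq> S" "K \<subseteq> T" "card K + 1 = r"
  shows "chain_dist walk S T \<le> 1"
proof (rule chain_dist_le_1)
  have "card (S - K) = 1"
    using assms finite_basis[of S] by (subst card_Diff_subset) (auto simp: bases_def intro: finite_subset)
  then obtain u where "S - K = {u}" by (auto simp: card_1_singleton_iff)
  then have "u \<in> S" "S - {u} \<subseteq> T" using assms by auto
  then show "T \<in> set_pmf (walk S)" using assms by (auto simp: set_walk)
qed

section \<open>Coupling the completions of two neighbouring sets\<close>

text \<open>Two such sets would share the \<open>r - 1\<close> elements of \<open>K\<close>, while
  distinct members of \<open>N\<close> share at most \<open>r - 2\<close>.\<close>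

lemma excluded_extension_unique:
  assumes "card K + 1 = r" "X \<in> extensions K \<inter> N" "Y \<in> extensions K \<inter> N"
  shows "X = Y"
proof (rule ccontr)
  assume "X \<noteq> Y"
  then have "card (X \<inter> Y) + 2 \<le> r" using assms sparse by blast
  moreover have "card K \<le> card (X \<inter> Y)"
    using assms finite_E by (intro card_mono) (auto simp: extensions_def intro: finite_subset)
  ultimately show False using assms(1) by simp
qed

text \<open>The distance is left abstract so that the result applies to the chain distance and to
  its reverse. \<open>excl\<close> rules out one configuration, which is recovered later by
  exchanging \<open>a\<close> and \<open>b\<close>.\<close>

lemma transport_extensions_aux:
  fixes d :: "'a set \<Rightarrow> 'a set \<Rightarrow> enat"
  assumes refl: "\<And>S. d S S = 0"
    and triangle: "\<And>S T U. d S U \<le> d S T + d T U"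
    and near: "\<And>S T K. S \<in> bases \<Longrightarrow> T \<in> bases \<Longrightarrow> K \<subseteq> S \<Longrightarrow> K \<subseteq> T \<Longrightarrow>
      card K + 1 = r \<Longrightarrow> d S T \<le> 1"
    and J: "card J + 2 = r" "J \<subseteq> E" "a \<in> E - J" "b \<in> E - J" "a \<noteq> b"
    and ne: "extensions (insert a J) - N \<noteq> {}"
    and excl: "insert a (insert b J) \<in> N \<or> extensions (insert b J) \<inter> N = {} \<or>
      extensions (insert a J) \<inter> N \<noteq> {}"
  shows "transport_le d (pmf_of_set (extensions (insert a J) - N))
    (pmf_of_set (extensions (insert b J) - N)) 1"
proof -
  let ?U = "extensions (insert a J)" and ?V = "extensions (insert b J)"
  let ?M = "insert a (insert b J)"
  \<comment> \<open>The transposition is an involution that exchanges \<open>?U\<close> and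
    \<open>?V\<close> and fixes \<open>?M\<close>.\<close>
  define \<phi> :: "'a set \<Rightarrow> 'a set" where "\<phi> T = Transposition.transpose a b ` T" for T
  have "finite J" using J(2) finite_E by (rule finite_subset)
  note J = J this
  have cK: "card (insert a J) + 1 = r" "card (insert b J) + 1 = r"
    using J by auto
  have \<phi>\<phi> [simp]: "\<phi> (\<phi> T) = T" for T by (simp add: \<phi>_def image_comp)
  have inj: "inj_on \<phi> X" for X by (metis \<phi>\<phi> inj_onI)
  have \<phi>M: "\<phi> ?M = ?M"
    using J by (auto simp: \<phi>_def Transposition.transpose_def image_iff)
  have tJ: "Transposition.transpose a b ` J = J"
    using J by (auto simp: Transposition.transpose_def image_iff)
  have tE: "Transposition.transpose a b ` E = E"
    using J by (auto simp: Transposition.transpose_def image_iff)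
  have \<phi>V: "\<phi> T \<in> ?U" if "T \<in> ?V" for T
  proof -
    have "\<phi> T \<subseteq> E"
      using that image_mono[of T E "Transposition.transpose a b"] tE
      by (simp add: \<phi>_def extensions_def)
    moreover have "card (\<phi> T) = r" using that by (simp add: \<phi>_def extensions_def card_image)
    moreover have "insert a J \<subseteq> \<phi> T"
      using that image_mono[of "insert b J" T "Transposition.transpose a b"] tJ
      by (simp add: \<phi>_def extensions_def)
    ultimately show ?thesis by (simp add: extensions_def)
  qed
  have \<phi>U: "\<phi> T \<in> ?V" if "T \<in> ?U" for T
  proof -
    have "\<phi> T \<subseteq> E"
      using that image_mono[of T E "Transposition.transpose a b"] tE
      by (simp add: \<phi>_def extensions_def)
    moreover have "card (\<phi> T) = r" using that by (simp add: \<phi>_def extensions_def card_image)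
    moreover have "insert b J \<subseteq> \<phi> T"
      using that image_mono[of "insert a J" T "Transposition.transpose a b"] tJ
      by (simp add: \<phi>_def extensions_def)
    ultimately show ?thesis by (simp add: extensions_def)
  qed
  have im: "\<phi> ` ?V = ?U"
  proof
    show "?U \<subseteq> \<phi> ` ?V" using \<phi>U \<phi>\<phi> by (metis image_eqI subsetI)
  qed (use \<phi>V in blast)
  have M: "?M \<in> ?U" "?M \<in> ?V" using J by (auto simp: extensions_def)
  \<comment> \<open>A completion containing both \<open>a\<close> and \<open>b\<close> is fixed; any
    other trades \<open>b\<close> for \<open>a\<close> and keeps the \<open>r - 1\<close> elements
    of \<open>T - {b}\<close>.\<close>
  have step: "d (\<phi> T) T \<le> 1" if T: "T \<in> ?V - N" and \<phi>T: "\<phi> T \<in> ?U - N" for T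
  proof (cases "a \<in> T")
    case True
    then have "\<phi> T = T" using T by (auto simp: \<phi>_def Transposition.transpose_def image_iff extensions_def)
    then show ?thesis using refl by simp
  next
    case False
    then have "T - {b} \<subseteq> \<phi> T" by (auto simp: \<phi>_def Transposition.transpose_def image_iff)
    moreover have "card (T - {b}) + 1 = r"
      using T J by (auto simp: extensions_def card_Diff_singleton_if)
    ultimately show ?thesis
      using T \<phi>T by (intro near[of _ _ "T - {b}"]) (auto simp: bases_def extensions_def)
  qed
  have far: "d S T \<le> 2" if "S \<in> ?U - N" "T \<in> ?V - N" "?M \<notin> N" for S T
  proof -
    have "d S ?M \<le> 1" using that M cK J
      by (intro near[of _ _ "insert a J"]) (auto simp: bases_def extensions_def)
    moreover have "d ?M T \<le> 1" using that M cK J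
      by (intro near[of _ _ "insert b J"]) (auto simp: bases_def extensions_def)
    ultimately show ?thesis
      using triangle[of S T ?M] add_mono[of "d S ?M" 1 "d ?M T" 1] by (simp add: one_add_one)
  qed
  have fin: "finite (?V - N)" using finite_extensions by simp
  consider "?M \<in> N" | "?M \<notin> N" "?V \<inter> N = {}"
    | P Q where "?M \<notin> N" "P \<in> ?U \<inter> N" "Q \<in> ?V \<inter> N"
    using excl by blast
  then show ?thesis
  proof cases
    \<comment> \<open>By uniqueness \<open>?M\<close> is the only set missing on either side, so
      \<phi> restricts to a bijection between the remaining completions.\<close>
    case 1
    then have "?U \<inter> N = {?M}" "?V \<inter> N = {?M}"
      using excluded_extension_unique cK M by blast+
    then have UV: "?U - N = ?U - {?M}" "?V - N = ?V - {?M}" by blast+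
    have im': "\<phi> ` (?V - N) = ?U - N"
      unfolding UV using im \<phi>M inj by (simp add: inj_on_image_set_diff[of \<phi> UNIV])
    then have "?V - N \<noteq> {}" using ne by auto
    then have "transport_le d (pmf_of_set (\<phi> ` (?V - N))) (pmf_of_set (?V - N)) 1"
      using im' by (intro transport_le_bij fin inj step) blast+
    then show ?thesis unfolding im' .
  next
    case 2
    have VN: "?V - N = ?V" using 2 by blast
    show ?thesis
    \<comment> \<open>\<open>z\<close> is the partner of the set excluded from \<open>?U\<close>. If
      none is excluded, the description denotes an arbitrary set, but then no point is
      unmatched.\<close>
    proof (rule transport_le_match[where \<phi> = \<phi> and M = ?M and z = "\<phi> (THE X. X \<in> ?U \<inter> N)"])
      show "?U - N \<subseteq> \<phi> ` (?V - N)" unfolding VN im by blast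
      show "T = \<phi> (THE X. X \<in> ?U \<inter> N)" if "T \<in> ?V - N" "\<phi> T \<notin> ?U - N" for T
      proof -
        have "\<phi> T \<in> ?U \<inter> N" using that \<phi>V by blast
        then have "(THE X. X \<in> ?U \<inter> N) = \<phi> T"
          by (rule the_equality) (rule excluded_extension_unique[OF cK(1) _ \<open>\<phi> T \<in> ?U \<inter> N\<close>])
        then show ?thesis by simp
      qed
    qed (use fin M 2 ne inj \<phi>M far step refl in auto)
  next
    case (3 P Q)
    then have "?U \<inter> N = {P}" "?V \<inter> N = {Q}"
      using excluded_extension_unique cK by blast+
    then have UV: "?U - N = ?U - {P}" "?V - N = ?V - {Q}" by blast+
    \<comment> \<open>The transposition leaves \<open>\<phi> P\<close> and \<open>\<phi> Q\<close> without partner, so \<open>\<psi>\<close> matches them.\<close>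
    let ?\<psi> = "\<lambda>T. Transposition.transpose P (\<phi> Q) (\<phi> T)"
    have im\<psi>: "?\<psi> ` (?V - N) = ?U - N"
    proof -
      have "\<phi> ` (?V - N) = ?U - {\<phi> Q}"
        unfolding UV using im inj by (simp add: inj_on_image_set_diff[of \<phi> UNIV])
      \<comment> \<open>If \<open>P\<close> equals \<phi>\<open>Q\<close>, this transposition is the
        identity.\<close>
      moreover have "Transposition.transpose P (\<phi> Q) ` (?U - {\<phi> Q}) = ?U - {P}"
        using 3 \<phi>V[of Q]
        by (auto simp: Transposition.transpose_def image_iff split: if_splits)
      ultimately show ?thesis unfolding UV by (metis image_image)
    qed
    have MPQ: "?M \<noteq> P" "?M \<noteq> \<phi> Q" using 3 \<phi>M \<phi>\<phi>[of Q] by auto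
    show ?thesis
    \<comment> \<open>Only \<phi>\<open>P\<close> can get a new partner, namely
      \<phi>\<open>Q\<close>; the two are within distance 2 through \<open>?M\<close>.\<close>
    proof (rule transport_le_match[where \<phi> = ?\<psi> and M = ?M and z = "\<phi> P"])
      show "inj_on ?\<psi> (?V - N)" by (intro inj_onI) (metis \<phi>\<phi> transpose_involutory)
      show "d (?\<psi> T) T \<le> 1 \<or> T = \<phi> P \<and> d (?\<psi> T) T \<le> 2" if "T \<in> ?V - N" "?\<psi> T \<in> ?U - N" for T
      proof (cases "T = \<phi> P")
        case True
        then show ?thesis using far that 3 by blast
      next
        case False
        then have "\<phi> T \<noteq> P" by auto
        moreover have "\<phi> T \<noteq> \<phi> Q" using that 3 by (metis DiffD2 IntD2 \<phi>\<phi>)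
        ultimately have "?\<psi> T = \<phi> T" by (simp add: Transposition.transpose_def)
        then show ?thesis using step that by metis
      qed
      show "?V - N \<noteq> {}" using M 3 by blast
      show "?U - N \<subseteq> ?\<psi> ` (?V - N)" unfolding im\<psi> ..
      show "T = \<phi> P" if "T \<in> ?V - N" "?\<psi> T \<notin> ?U - N" for T
        using that im\<psi> by blast
      show "?\<psi> ?M = ?M" using \<phi>M MPQ by (simp add: Transposition.transpose_def)
    qed (use fin ne M 3 far refl in blast)+
  qed
qed

lemma transport_extensions:
  assumes J: "card J + 2 = r" "J \<subseteq> E" "a \<in> E - J" "b \<in> E - J" "a \<noteq> b"
    and ne: "extensions (insert a J) - N \<noteq> {}" "extensions (insert b J) - N \<noteq> {}"
  shows "transport_le (chain_dist walk) (pmf_of_set (extensions (insert a J) - N))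
    (pmf_of_set (extensions (insert b J) - N)) 1"
proof (cases "insert a (insert b J) \<in> N \<or> extensions (insert b J) \<inter> N = {} \<or>
      extensions (insert a J) \<inter> N \<noteq> {}")
  case True
  show ?thesis
    by (rule transport_extensions_aux[OF chain_dist_self chain_dist_triangle dist_le_1 J ne(1) True])
next
  case False
  show ?thesis
  \<comment> \<open>What remains is an excluded set on the \<open>b\<close> side only; with
    \<open>a\<close> and \<open>b\<close> exchanged it falls under the second alternative of
    \<open>excl\<close>.\<close>
  proof (rule transport_le_swap, rule transport_extensions_aux)
    show "chain_dist walk U S \<le> chain_dist walk T S + chain_dist walk U T" for S T U
      using chain_dist_triangle[of walk U S T] by (simp add: add.commute)
    show "insert b (insert a J) \<in> N \<or> extensions (insert a J) \<inter> N = {} \<or>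
        extensions (insert b J) \<inter> N \<noteq> {}"
      using False by blast
  qed (use J ne in \<open>auto simp: chain_dist_self dist_le_1\<close>)
qed

section \<open>Contraction for adjacent bases\<close>

text \<open>With probability \<open>1 / r\<close> the walks drop \<open>a\<close> and
  \<open>b\<close> and continue identically; each of the other \<open>r - 1\<close> choices costs at
  most 1.\<close>

lemma transport_walk_adjacent:
  assumes S: "S \<in> bases" and T: "T \<in> set_pmf (walk S)"
  shows "transport_le (chain_dist walk) (walk S) (walk T) (ennreal (1 - 1 / r))"
proof (cases "S = T")
  case True
  show ?thesis
    unfolding True by (rule transport_le_mono[OF transport_le_refl]) (simp_all add: chain_dist_self)
next
  case False
  have Tb: "T \<in> bases" using S T by (simp add: set_walk)
  obtain a where a: "a \<in> S" "S - {a} \<subseteq> T" using S T by (auto simp: set_walk)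
  have card: "card S = r" "card T = r" "S \<subseteq> E" "T \<subseteq> E" using S Tb by (auto simp: bases_def)
  note fin = finite_basis[OF S] finite_basis[OF Tb]
  have "card (T - (S - {a})) = 1"
    using a card fin rank_pos by (simp add: card_Diff_subset card_Diff_singleton_if)
  then obtain b where "T - (S - {a}) = {b}" by (auto simp: card_1_singleton_iff)
  then have Teq: "T = insert b (S - {a})" and b: "b \<notin> S - {a}" using a by auto
  have ab: "a \<noteq> b" "b \<notin> S" using Teq b False a by auto
  have "Transposition.transpose a b ` S = T"
    using a ab Teq by (auto simp: Transposition.transpose_def image_iff)
  \<comment> \<open>The image of a uniform element of \<open>S\<close> is uniform on
    \<open>T\<close>, so one random \<open>u\<close> drives both walks.\<close>
  then have "pmf_of_set T = map_pmf (Transposition.transpose a b) (pmf_of_set S)"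
    using fin S basis_nonempty by (subst map_pmf_of_set_inj) auto
  then have wT: "walk T = bind_pmf (pmf_of_set S)
      (\<lambda>u. pmf_of_set (extensions (T - {Transposition.transpose a b u}) - N))"
    by (simp add: basis_exchange_walk_def bind_map_pmf bases_extensions)
  have wS: "walk S = bind_pmf (pmf_of_set S) (\<lambda>u. pmf_of_set (extensions (S - {u}) - N))"
    by (simp add: basis_exchange_walk_def bases_extensions)
  have "transport_le (chain_dist walk) (pmf_of_set (extensions (S - {u}) - N))
      (pmf_of_set (extensions (T - {Transposition.transpose a b u}) - N)) (if u = a then 0 else 1)"
    if "u \<in> set_pmf (pmf_of_set S)" for u
  proof (cases "u = a")
    case True
    then have "T - {Transposition.transpose a b u} = S - {u}" using Teq ab by auto
    then show ?thesis using True by (simp add: transport_le_refl chain_dist_self)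
  next
    case u: False
    have uS: "u \<in> S" using that fin basis_nonempty[OF S] by simp
    define J where "J = S - {a, u}"
    have S': "S - {u} = insert a J" using u a by (auto simp: J_def)
    have T': "T - {Transposition.transpose a b u} = insert b J"
      using u uS ab Teq by (auto simp: J_def Transposition.transpose_def)
    have "insert a (insert u J) = S" "a \<notin> insert u J" "u \<notin> J" "finite J"
      using u a uS fin by (auto simp: J_def)
    then have cJ: "card J + 2 = r" using card by auto
    \<comment> \<open>\<open>S\<close> and \<open>T\<close> themselves witness that neither set of
      completions is empty.\<close>
    have "S \<in> extensions (insert a J) - N" "T \<in> extensions (insert b J) - N"
      using S Tb S' T' by (auto simp: extensions_def bases_def)
    then show ?thesis
      using u unfolding S' T'
      by (simp, intro transport_extensions)
        (use cJ fin ab a card Teq in \<open>auto simp: J_def\<close>)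
  qed
  from transport_le_bind[of "pmf_of_set S", OF this]
  have tr: "transport_le (chain_dist walk) (walk S) (walk T)
      (\<integral>\<^sup>+ u. (if u = a then 0 else 1) \<partial>measure_pmf (pmf_of_set S))"
    unfolding wS wT .
  have "(\<integral>\<^sup>+ u. (if u = a then 0 else 1) \<partial>measure_pmf (pmf_of_set S)) =
      (\<Sum>u\<in>S. if u = a then 0 else 1) / of_nat r"
    using fin basis_nonempty[OF S] card by (simp add: nn_integral_pmf_of_set)
  also have "(\<Sum>u\<in>S. if u = a then 0 else 1) = (of_nat (r - 1) :: ennreal)"
    using a fin card by (subst sum.remove[OF fin(1) a(1)]) simp
  also have "of_nat (r - 1) / of_nat r = ennreal (1 - 1 / r)"
    using rank_pos by (simp add: ennreal_of_nat_eq_real_of_nat divide_ennreal of_nat_diff field_simps)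
  finally show ?thesis using tr by simp
qed

lemma curvature_sparse_paving: "ollivier_ricci_curvature bases walk \<ge> ereal (1 / r)"
proof -
  have "ollivier_ricci_curvature bases walk \<ge> ereal (1 - (1 - 1 / r))"
    using rank_pos
    by (intro curvature_ge conjI transport_walk_adjacent) (auto simp: set_walk field_simps)
  then show ?thesis by simp
qed

end

section \<open>The Vamos matroid\<close>

text \<open>Distinct excluded sets share at most one block, hence at most two elements.\<close>

lemma sparse_paving_vamos:
  fixes A :: "nat \<Rightarrow> 'a set"
  assumes disj: "disjoint_family_on A {1..4}"
    and card2: "\<And>i. i \<in> {1..4} \<Longrightarrow> card (A i) = 2"
  shows "sparse_paving (vamos_ground A)
    {A 1 \<union> A 2, A 1 \<union> A 3, A 1 \<union> A 4, A 2 \<union> A 3, A 2 \<union> A 4} 4"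
proof
  have fin: "finite (A i)" if "i \<in> {1..4}" for i
    using card2[OF that] by (intro card_ge_0_finite) simp
  then show "finite (vamos_ground A)" by (simp add: vamos_ground_def)
  have inter: "A i \<inter> A j = {}" if "i \<in> {1..4}" "j \<in> {1..4}" "i \<noteq> j" for i j
    using disj that by (auto simp: disjoint_family_on_def)
  show "card (X \<inter> Y) + 2 \<le> 4"
    if "X \<in> {A 1 \<union> A 2, A 1 \<union> A 3, A 1 \<union> A 4, A 2 \<union> A 3, A 2 \<union> A 4}"
      "Y \<in> {A 1 \<union> A 2, A 1 \<union> A 3, A 1 \<union> A 4, A 2 \<union> A 3, A 2 \<union> A 4}" "X \<noteq> Y" for X Y
    using that
    by (elim insertE emptyE;
        simp add: Int_Un_distrib Int_Un_distrib2 inter card2 del: One_nat_def)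
qed simp

theorem lemma4p5:
  fixes A :: "nat \<Rightarrow> 'a set"
  assumes "disjoint_family_on A {1..4}"
    and "\<And>i. i \<in> {1..4} \<Longrightarrow> card (A i) = 2"
  shows "ollivier_ricci_curvature (vamos_bases A) (basis_exchange_walk (vamos_bases A)) > 0"
proof -
  interpret sparse_paving "vamos_ground A"
    "{A 1 \<union> A 2, A 1 \<union> A 3, A 1 \<union> A 4, A 2 \<union> A 3, A 2 \<union> A 4}" 4
    using assms by (rule sparse_paving_vamos)
  have "bases = vamos_bases A" by (simp only: bases_def vamos_bases_def)
  \<comment> \<open>Rank 4 gives the explicit lower bound 1/4 for the curvature.\<close>
  moreover have "0 < ereal (1 / real 4)" by simp
  ultimately show ?thesis
    using curvature_sparse_paving by (metis order_less_le_trans)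
qed

end
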